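(* Let $X$ be a topological space. The sets $\mathcal{H}(X)$ and $\mathcal{H}_b(X)$ are subgroups of $\mathcal{F}(X,\mathbb{Z})$.
   Context: $\mathcal{F}(X,\mathbb{Z})$ is the group of all functions $X\to\mathbb{Z}$ under pointwise addition. A function $f:X\to\mathbb{Z}$ is residual if $f^{-1}(0)$ contains an open dense subset of $X$. $\mathcal{H}(X)$ is the set of all residual functions on $X$, and $\mathcal{H}_b(X)$ is the set of all bounded residual functions on $X$. *)

theory Defs
  imports "HOL-Analysis.Analysis" "HOL-Algebra.Product_Groups"
begin

text \<open>
  A function on the space \<open>X\<close> is represented by a HOL function that is \<open>undefined\<close> outside
  \<open>topspace X\<close> (\<open>extensional\<close>), so that equality of group elements is equality of functions
  on \<open>X\<close>.
\<close>

definition int_functions :: "'a topology \<Rightarrow> ('a \<Rightarrow> int) monoid"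
  where "int_functions X = product_group (topspace X) (\<lambda>_. integer_group)"

lemma carrier_int_functions: "carrier (int_functions X) = (topspace X \<rightarrow>\<^sub>E UNIV)"
  by (simp add: int_functions_def integer_group_def)

lemma mult_int_functions: "f \<otimes>\<^bsub>int_functions X\<^esub> g = (\<lambda>x\<in>topspace X. f x + g x)"
  by (simp add: int_functions_def integer_group_def)

lemma group_int_functions: "group (int_functions X)"
  by (simp add: int_functions_def)

definition residual :: "'a topology \<Rightarrow> ('a \<Rightarrow> int) \<Rightarrow> bool"
  where "residual X f \<longleftrightarrow>
    (\<exists>U. openin X U \<and> X closure_of U = topspace X \<and> U \<subseteq> {x \<in> topspace X. f x = 0})"

definition residual_functions :: "'a topology \<Rightarrow> ('a \<Rightarrow> int) set"
  where "residual_functions X = {f \<in> carrier (int_functions X). residual X f}"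

definition bounded_residual_functions :: "'a topology \<Rightarrow> ('a \<Rightarrow> int) set"
  where "bounded_residual_functions X = {f \<in> residual_functions X. \<exists>B. \<forall>x \<in> topspace X. \<bar>f x\<bar> \<le> B}"

end

theory Submission
  imports Defs
begin

text \<open>
  A residual function is one whose zero set contains a dense open set. The neutral element vanishes
  everywhere, negation does not change the zero set, and a sum vanishes wherever both summands do.
  So the only topological input is that two dense open sets meet in a dense open set, which is
  lemma \<open>dense_openin_Int\<close>. Boundedness passes to sums and negatives by the triangle inequality.
\<close>

lemma one_int_functions: "\<one>\<^bsub>int_functions X\<^esub> = (\<lambda>x\<in>topspace X. 0)"
  by (simp add: int_functions_def integer_group_def)

lemma inv_int_functions:
  assumes "f \<in> carrier (int_functions X)"
  shows "inv\<^bsub>int_functions X\<^esub> f = (\<lambda>x\<in>topspace X. - f x)"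
  using assms by (simp add: int_functions_def inv_product_group)

text \<open>
  For an open \<open>U\<close>, intersecting with the closure of \<open>V\<close> or with \<open>V\<close> itself gives the same closure;
  when \<open>V\<close> is dense, the former intersection is all of \<open>U\<close>.
\<close>

lemma dense_openin_Int:
  assumes "openin X U" "X closure_of U = topspace X" "X closure_of V = topspace X"
  shows "X closure_of (U \<inter> V) = topspace X"
proof -
  have "X closure_of (U \<inter> V) = X closure_of (U \<inter> X closure_of V)"
    using assms(1) by (simp add: closure_of_openin_Int_closure_of)
  also have "U \<inter> X closure_of V = U"
    using openin_subset[OF assms(1)] assms(3) by auto
  finally show ?thesis
    using assms(2) by simp
qed

lemma residual_if_zero:
  assumes "residual X f" "\<And>x. x \<in> topspace X \<Longrightarrow> f x = 0 \<Longrightarrow> g x = 0"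
  shows "residual X g"
  using assms unfolding residual_def by blast

lemma residual_if_common_zero:
  assumes "residual X f" "residual X g"
    and "\<And>x. x \<in> topspace X \<Longrightarrow> f x = 0 \<Longrightarrow> g x = 0 \<Longrightarrow> h x = 0"
  shows "residual X h"
proof -
  obtain U where U: "openin X U" "X closure_of U = topspace X" "U \<subseteq> {x \<in> topspace X. f x = 0}"
    using assms(1) unfolding residual_def by blast
  obtain V where V: "openin X V" "X closure_of V = topspace X" "V \<subseteq> {x \<in> topspace X. g x = 0}"
    using assms(2) unfolding residual_def by blast
  have "openin X (U \<inter> V)" "X closure_of (U \<inter> V) = topspace X"
    using openin_Int[OF U(1) V(1)] dense_openin_Int[OF U(1,2) V(2)] by blast+
  moreover have "U \<inter> V \<subseteq> {x \<in> topspace X. h x = 0}"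
    using U V assms(3) by blast
  ultimately show ?thesis
    unfolding residual_def by blast
qed

lemma residual_zero: "residual X (\<lambda>x\<in>topspace X. 0)"
  unfolding residual_def by (rule exI[of _ "topspace X"]) auto

lemma subgroup_residual_functions: "subgroup (residual_functions X) (int_functions X)"
proof (rule group.subgroupI[OF group_int_functions])
  show "residual_functions X \<subseteq> carrier (int_functions X)"
    by (auto simp: residual_functions_def)
  have "(\<lambda>x\<in>topspace X. 0) \<in> residual_functions X"
    using residual_zero by (auto simp: residual_functions_def carrier_int_functions)
  then show "residual_functions X \<noteq> {}"
    by blast
next
  fix f assume "f \<in> residual_functions X"
  then show "inv\<^bsub>int_functions X\<^esub> f \<in> residual_functions X"
    by (auto simp: residual_functions_def inv_int_functions carrier_int_functions
        elim: residual_if_zero)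
next
  fix f g assume "f \<in> residual_functions X" "g \<in> residual_functions X"
  then show "f \<otimes>\<^bsub>int_functions X\<^esub> g \<in> residual_functions X"
    by (auto simp: residual_functions_def mult_int_functions carrier_int_functions
        elim: residual_if_common_zero)
qed

lemma subgroup_bounded_residual_functions:
  "subgroup (bounded_residual_functions X) (int_functions X)"
proof (rule group.subgroupI[OF group_int_functions])
  note closed = subgroup.m_closed[OF subgroup_residual_functions]
    subgroup.m_inv_closed[OF subgroup_residual_functions]
    subgroup.one_closed[OF subgroup_residual_functions]
  show carrier: "bounded_residual_functions X \<subseteq> carrier (int_functions X)"
    by (auto simp: bounded_residual_functions_def residual_functions_def)
  have "\<one>\<^bsub>int_functions X\<^esub> \<in> bounded_residual_functions X"
    using closed(3)[of X] by (auto simp: bounded_residual_functions_def one_int_functions)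
  then show "bounded_residual_functions X \<noteq> {}"
    by blast
  fix f assume f: "f \<in> bounded_residual_functions X"
  then obtain B where B: "\<forall>x \<in> topspace X. \<bar>f x\<bar> \<le> B"
    by (auto simp: bounded_residual_functions_def)
  have "f \<in> carrier (int_functions X)"
    using f carrier by blast
  then show "inv\<^bsub>int_functions X\<^esub> f \<in> bounded_residual_functions X"
    using f closed(2)[of f X] B by (auto simp: bounded_residual_functions_def inv_int_functions)
  fix g assume g: "g \<in> bounded_residual_functions X"
  then obtain C where C: "\<forall>x \<in> topspace X. \<bar>g x\<bar> \<le> C"
    by (auto simp: bounded_residual_functions_def)
  have "\<forall>x \<in> topspace X. \<bar>f x + g x\<bar> \<le> B + C"
    using B C by (meson abs_triangle_ineq add_mono order_trans)
  then show "f \<otimes>\<^bsub>int_functions X\<^esub> g \<in> bounded_residual_functions X"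
    using f g closed(1)[of f X g] by (auto simp: bounded_residual_functions_def mult_int_functions)
qed

theorem proposition3p4:
  fixes X :: "'a topology"
  shows "subgroup (residual_functions X) (int_functions X) \<and>
    subgroup (bounded_residual_functions X) (int_functions X)"
  using subgroup_residual_functions subgroup_bounded_residual_functions by blast

end
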